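(* Let $X$, $Y$ be topological spaces where $Y$ is a connected $m$-dimensional topological manifold without boundary, with $m\geq 2$. Let $g:X\to Y$ be a continuous map such that $\mathrm{secat}(g)=1$ (for example, when $g$ is a homotopy equivalence). If $Y$ has the fixed point property, then $(X,Y;g)$ has the coincidence property (and $\mathrm{sec}_{g}(\pi_{2,1}^{Y})=2$). In particular, $Y$ has the fixed point property if and only if $(X,Y;g)$ has the coincidence property.
   Context: Maps are continuous. A space $Y$ has the fixed point property (FPP) if for every map $f:Y\to Y$ there is $y\in Y$ with $f(y)=y$. For a map $g:X\to Y$, the triple $(X,Y;g)$ has the coincidence property (CP) if for every map $f:X\to Y$ there is a point $x\in X$ with $f(x)=g(x)$. $F(Y,2)=\{(y_1,y_2)\in Y^2\mid y_1\neq y_2\}$ with the subspace topology from $Y^2$, and $\pi_{2,1}^Y:F(Y,2)\to Y$ is $\pi_{2,1}^Y(y_1,y_2)=y_1$. For a map $f:A\to B$: the sectional number $\mathrm{sec}(f)$ (respectively, the sectional category $\mathrm{secat}(f)$) is the minimal cardinality of open covers of $B$ such that for each element $U$ of the cover there is a map $s:U\to A$ with $f\circ s$ equal (respectively, homotopic) to the inclusion $U\hookrightarrow B$ (with value $\infty$ if no finite such cover exists). For maps $p:E\to B$ and $g:X\to B$, the relative sectional number is $\mathrm{sec}_g(p)=\mathrm{sec}(g^\ast(p))$, where $g^\ast(p):X\times_B E\to X$, $(x,e)\mapsto x$, and $X\times_B E=\{(x,e)\in X\times E: g(x)=p(e)\}$. *)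

theory Defs
  imports "HOL-Analysis.Analysis"
begin

text \<open>Spaces are abstract topologies (type \<open>'a topology\<close>), so a space may be carried by any set and
  may be empty.\<close>

definition second_countable_space :: "'a topology \<Rightarrow> bool" where
  "second_countable_space X \<longleftrightarrow>
     (\<exists>\<B>. countable \<B> \<and> (\<forall>V\<in>\<B>. openin X V) \<and>
          (\<forall>U x. openin X U \<and> x \<in> U \<longrightarrow> (\<exists>V\<in>\<B>. x \<in> V \<and> V \<subseteq> U)))"

text \<open>Manifolds are without boundary: every point has a neighbourhood homeomorphic to an open
  subset of the whole Euclidean space, not of a half-space. Connectedness and non-emptiness are not
  included.\<close>

definition topological_manifold :: "nat \<Rightarrow> 'a topology \<Rightarrow> bool" where
  "topological_manifold m Y \<longleftrightarrow>
     Hausdorff_space Y \<and> second_countable_space Y \<and>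
     (\<forall>y\<in>topspace Y. \<exists>U V. openin Y U \<and> y \<in> U \<and> openin (Euclidean_space m) V \<and>
        subtopology Y U homeomorphic_space subtopology (Euclidean_space m) V)"

definition fixed_point_property :: "'a topology \<Rightarrow> bool" where
  "fixed_point_property Y \<longleftrightarrow>
     (\<forall>f. continuous_map Y Y f \<longrightarrow> (\<exists>y\<in>topspace Y. f y = y))"

definition coincidence_property :: "'a topology \<Rightarrow> 'b topology \<Rightarrow> ('a \<Rightarrow> 'b) \<Rightarrow> bool" where
  "coincidence_property X Y g \<longleftrightarrow>
     (\<forall>f. continuous_map X Y f \<longrightarrow> (\<exists>x\<in>topspace X. f x = g x))"

definition homotopy_equivalence :: "'a topology \<Rightarrow> 'b topology \<Rightarrow> ('a \<Rightarrow> 'b) \<Rightarrow> bool" where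
  "homotopy_equivalence X Y g \<longleftrightarrow>
     continuous_map X Y g \<and>
     (\<exists>h. continuous_map Y X h \<and>
          homotopic_with (\<lambda>_. True) X X (h \<circ> g) id \<and>
          homotopic_with (\<lambda>_. True) Y Y (g \<circ> h) id)"

definition configuration_space2 :: "'a topology \<Rightarrow> ('a \<times> 'a) topology" where
  "configuration_space2 Y = subtopology (prod_topology Y Y) {(y1, y2). y1 \<noteq> y2}"

text \<open>In the next two definitions the infimum over the empty family is \<open>\<infinity>\<close>, and every other infimum
  of extended naturals is attained, so it is a minimum. The empty cover is allowed: both numbers are
  \<open>0\<close> exactly when the codomain is empty.\<close>

definition sectional_number :: "'a topology \<Rightarrow> 'b topology \<Rightarrow> ('a \<Rightarrow> 'b) \<Rightarrow> enat" where
  "sectional_number A B f =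
     Inf {enat (card \<U>) | \<U>. finite \<U> \<and> \<Union>\<U> = topspace B \<and>
       (\<forall>U\<in>\<U>. openin B U \<and>
          (\<exists>s. continuous_map (subtopology B U) A s \<and> (\<forall>x\<in>U. f (s x) = x)))}"

definition sectional_category :: "'a topology \<Rightarrow> 'b topology \<Rightarrow> ('a \<Rightarrow> 'b) \<Rightarrow> enat" where
  "sectional_category A B f =
     Inf {enat (card \<U>) | \<U>. finite \<U> \<and> \<Union>\<U> = topspace B \<and>
       (\<forall>U\<in>\<U>. openin B U \<and>
          (\<exists>s. continuous_map (subtopology B U) A s \<and>
               homotopic_with (\<lambda>_. True) (subtopology B U) B (f \<circ> s) id))}"

definition fibre_product ::
  "'x topology \<Rightarrow> 'e topology \<Rightarrow> ('x \<Rightarrow> 'b) \<Rightarrow> ('e \<Rightarrow> 'b) \<Rightarrow> ('x \<times> 'e) topology" where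
  "fibre_product X E g p = subtopology (prod_topology X E) {(x, e). g x = p e}"

definition relative_sectional_number ::
  "'x topology \<Rightarrow> 'e topology \<Rightarrow> ('x \<Rightarrow> 'b) \<Rightarrow> ('e \<Rightarrow> 'b) \<Rightarrow> enat" where
  "relative_sectional_number X E g p = sectional_number (fibre_product X E g p) X fst"

end

theory Submission
  imports Defs
begin

text \<open>A section up to homotopy \<open>s\<close> of \<open>g\<close> and a map \<open>f\<close> without coincidence with \<open>g\<close> give
  \<open>f \<circ> s\<close>, which avoids \<open>g \<circ> s\<close> everywhere. Lifting the homotopy from \<open>g \<circ> s\<close> to the identity
  through the Fadell-Neuwirth fibration \<open>F(Y,2) \<rightarrow> Y\<close> yields a self-map of \<open>Y\<close> without fixed point.
  Only the following part of that fibration theorem is needed. In a chart, a point \<open>z\<close> can be pushed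
  along while \<open>a\<close> moves to \<open>b\<close>, so that it never hits the moving point, and points far from \<open>a\<close> stay
  put. These local pushes are composed along the homotopy in countably many steps: the \<open>k\<close>-th step
  advances the time from \<open>\<tau>\<^sub>k\<close> to \<open>\<tau>\<^sub>k\<^sub>+\<^sub>1 = max \<tau>\<^sub>k u\<^sub>k\<close>, where \<open>u\<^sub>k\<close> is a bump function, and the
  process is locally stationary as soon as the time has reached 1.\<close>

subsection \<open>Pushing points in Euclidean space\<close>

text \<open>Points of \<open>Euclidean_space m\<close> are the real sequences vanishing from index
  \<open>m\<close> on, with the topology induced from the product. A finite sum of coordinate
  distances makes continuity and all estimates a matter of single coordinates.\<close>

definition l1_dist :: "nat \<Rightarrow> (nat \<Rightarrow> real) \<Rightarrow> (nat \<Rightarrow> real) \<Rightarrow> real" where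
  "l1_dist m x y = (\<Sum>i<m. \<bar>x i - y i\<bar>)"

lemma l1_dist_nonneg: "0 \<le> l1_dist m x y"
  by (simp add: l1_dist_def sum_nonneg)

lemma l1_dist_self [simp]: "l1_dist m x x = 0"
  by (simp add: l1_dist_def)

lemma l1_dist_commute: "l1_dist m x y = l1_dist m y x"
  by (simp add: l1_dist_def abs_minus_commute)

lemma l1_dist_triangle: "l1_dist m x z \<le> l1_dist m x y + l1_dist m y z"
  unfolding l1_dist_def sum.distrib [symmetric] by (rule sum_mono) simp

lemma component_le_l1_dist: "i < m \<Longrightarrow> \<bar>x i - y i\<bar> \<le> l1_dist m x y"
  unfolding l1_dist_def by (rule member_le_sum) auto

lemma l1_dist_eq_0_imp:
  assumes "x \<in> topspace (Euclidean_space m)" "y \<in> topspace (Euclidean_space m)" "l1_dist m x y = 0"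
  shows "x = y"
proof
  fix i
  show "x i = y i"
    using assms component_le_l1_dist [of i m x y]
    by (cases "i < m") (auto simp: topspace_Euclidean_space)
qed

lemma continuous_map_Euclidean_component:
  assumes "continuous_map T (Euclidean_space m) f"
  shows "continuous_map T euclideanreal (\<lambda>x. f x i)"
  using assms by (simp add: Euclidean_space_def continuous_map_in_subtopology continuous_map_componentwise_UNIV)

lemma continuous_map_l1_dist:
  assumes "continuous_map T (Euclidean_space m) f" "continuous_map T (Euclidean_space m) g"
  shows "continuous_map T euclideanreal (\<lambda>x. l1_dist m (f x) (g x))"
  unfolding l1_dist_def
  by (intro continuous_intros continuous_map_Euclidean_component [OF assms(1)]
      continuous_map_Euclidean_component [OF assms(2)]) auto

text \<open>The vector \<open>b - a\<close> is added with a weight that falls linearly from 1 at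
  \<open>z = a\<close> to 0 at distance \<open>r\<close>. So \<open>a\<close> lands on
  \<open>b\<close>, and the formula is jointly continuous in \<open>a\<close>, \<open>b\<close> and
  \<open>z\<close>, which matters because both ends of a move vary with the parameter.\<close>

definition push :: "nat \<Rightarrow> real \<Rightarrow> (nat \<Rightarrow> real) \<Rightarrow> (nat \<Rightarrow> real) \<Rightarrow> (nat \<Rightarrow> real) \<Rightarrow> nat \<Rightarrow> real" where
  "push m r a b z = (\<lambda>i. z i + max 0 (1 - l1_dist m z a / r) * (b i - a i))"

lemma push_same [simp]: "push m r a a z = z"
  by (simp add: push_def)

lemma push_far: "\<lbrakk>0 < r; r \<le> l1_dist m z a\<rbrakk> \<Longrightarrow> push m r a b z = z"
  by (simp add: push_def max_def)

lemma push_in_Euclidean_space: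
  "\<lbrakk>a \<in> topspace (Euclidean_space m); b \<in> topspace (Euclidean_space m);
    z \<in> topspace (Euclidean_space m)\<rbrakk> \<Longrightarrow> push m r a b z \<in> topspace (Euclidean_space m)"
  by (simp add: push_def topspace_Euclidean_space)

text \<open>If \<open>z\<close> has distance d from \<open>a\<close>, the displacement is at most (1
  - d/r) r = r - d, exactly what is left up to the radius. This keeps pushed points inside the range
  of a chart.\<close>

lemma l1_dist_push_le:
  assumes "l1_dist m z a \<le> r" "l1_dist m b a \<le> r" "0 < r"
  shows "l1_dist m (push m r a b z) a \<le> r"
proof -
  define c where "c = 1 - l1_dist m z a / r"
  have c: "0 \<le> c" "max 0 c = c" using assms by (auto simp: c_def)
  have "l1_dist m (push m r a b z) a \<le> (\<Sum>i<m. \<bar>z i - a i\<bar> + c * \<bar>b i - a i\<bar>)"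
    unfolding l1_dist_def [of m "push m r a b z"]
  proof (rule sum_mono)
    fix i
    have "push m r a b z i - a i = (z i - a i) + c * (b i - a i)"
      using c by (simp add: push_def c_def)
    then show "\<bar>push m r a b z i - a i\<bar> \<le> \<bar>z i - a i\<bar> + c * \<bar>b i - a i\<bar>"
      using c by (metis abs_mult abs_of_nonneg abs_triangle_ineq)
  qed
  also have "\<dots> = l1_dist m z a + c * l1_dist m b a"
    by (simp add: l1_dist_def sum.distrib sum_distrib_left)
  also have "\<dots> \<le> l1_dist m z a + c * r"
    using assms c by (simp add: mult_left_mono)
  also have "\<dots> = r"
    using assms by (simp add: c_def field_simps)
  finally show ?thesis .
qed

text \<open>Arriving at \<open>b\<close> means z - a = e (b - a) with e = min 1 (d/r), where d is
  the distance from \<open>z\<close> to \<open>a\<close>. Taking lengths gives d r \<le> d |b - a|,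
  and since |b - a| < r this forces d = 0.\<close>

lemma push_eq_target_imp:
  assumes "l1_dist m b a < r" "push m r a b z = b"
    and E: "a \<in> topspace (Euclidean_space m)" "z \<in> topspace (Euclidean_space m)"
  shows "z = a"
proof -
  have r: "0 < r" using assms(1) l1_dist_nonneg [of m b a] by linarith
  define d where "d = l1_dist m z a"
  define e where "e = min 1 (d / r)"
  have d: "0 \<le> d" by (simp add: d_def l1_dist_nonneg)
  have e: "0 \<le> e" "e \<le> d / r" "max 0 (1 - d / r) = 1 - e" using d r by (auto simp: e_def)
  have "z i - a i = e * (b i - a i)" for i
  proof -
    have "z i + (1 - e) * (b i - a i) = b i"
      using fun_cong [OF assms(2), of i] e(3) by (simp add: push_def d_def)
    then show ?thesis by (simp add: algebra_simps)
  qed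
  then have "d = e * l1_dist m b a"
    unfolding d_def l1_dist_def using e(1) by (simp add: abs_mult sum_distrib_left)
  also have "\<dots> \<le> d / r * l1_dist m b a"
    using e l1_dist_nonneg mult_right_mono by blast
  finally have "d * r \<le> d * l1_dist m b a" using r by (simp add: field_simps)
  then have "\<not> 0 < d"
    using mult_strict_left_mono [OF assms(1), of d] by linarith
  then have "d = 0" using d by simp
  then show ?thesis using l1_dist_eq_0_imp [OF E(2,1)] by (simp add: d_def)
qed

lemma continuous_map_push:
  assumes "continuous_map T (Euclidean_space m) f" "continuous_map T (Euclidean_space m) g"
    "continuous_map T (Euclidean_space m) h" "0 < r"
  shows "continuous_map T (Euclidean_space m) (\<lambda>x. push m r (f x) (g x) (h x))"
proof -
  have E: "f x \<in> topspace (Euclidean_space m)" "g x \<in> topspace (Euclidean_space m)"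
     "h x \<in> topspace (Euclidean_space m)" if "x \<in> topspace T" for x
    using assms that by (auto simp: continuous_map_def)
  have "continuous_map T euclideanreal (\<lambda>x. push m r (f x) (g x) (h x) i)" for i
    unfolding push_def using \<open>0 < r\<close>
    by (intro continuous_intros continuous_map_l1_dist [OF assms(3,1)]
        continuous_map_Euclidean_component [OF assms(1)] continuous_map_Euclidean_component [OF assms(2)]
        continuous_map_Euclidean_component [OF assms(3)]) auto
  then show ?thesis
    unfolding Euclidean_space_def continuous_map_in_subtopology continuous_map_componentwise_UNIV
    using push_in_Euclidean_space [OF E(1) E(2) E(3)]
    by (auto simp: topspace_Euclidean_space)
qed

section \<open>Closed balls in Euclidean space: existence inside open sets, and compactness\<close>

text \<open>Each factor of a basic open box contains a closed interval about \<open>c i\<close>.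
  Only coordinates below \<open>m\<close> can differ from those of \<open>c\<close>, so the least of
  finitely many radii works.\<close>

lemma openin_Euclidean_space_contains_l1_cball:
  assumes "openin (Euclidean_space m) V" "c \<in> V"
  obtains r where "0 < r" "{x \<in> topspace (Euclidean_space m). l1_dist m x c \<le> r} \<subseteq> V"
proof -
  obtain W where W: "openin (powertop_real UNIV) W" "V = W \<inter> {x. \<forall>i\<ge>m. x i = 0}"
    using assms(1) by (auto simp: Euclidean_space_def openin_subtopology)
  have "c \<in> W" using W assms by auto
  then obtain S where S: "\<And>i. open (S i)" "c \<in> Pi\<^sub>E UNIV S" "Pi\<^sub>E UNIV S \<subseteq> W"
    using W(1) unfolding openin_product_topology_alt by (auto, meson)
  have "\<exists>r>0. \<forall>x. \<bar>x - c i\<bar> \<le> r \<longrightarrow> x \<in> S i" for i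
  proof -
    have "c i \<in> S i" using S(2) by auto
    then obtain e where "0 < e" "cball (c i) e \<subseteq> S i"
      using S(1) open_contains_cball by meson
    then show ?thesis by (auto simp: subset_iff dist_real_def abs_minus_commute)
  qed
  then obtain R where R: "\<And>i. 0 < R i" "\<And>i x. \<bar>x - c i\<bar> \<le> R i \<Longrightarrow> x \<in> S i" by metis
  \<comment> \<open>The inserted 1 keeps the set nonempty when \<open>m = 0\<close>.\<close>
  define r where "r = Min (insert 1 (R ` {..<m}))"
  have r: "0 < r" "\<And>i. i < m \<Longrightarrow> r \<le> R i"
    unfolding r_def using R(1) by (auto intro: Min_le)
  have "x \<in> V" if x: "x \<in> topspace (Euclidean_space m)" "l1_dist m x c \<le> r" for x
  proof -
    have "x i \<in> S i" for i
    proof (cases "i < m")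
      case True
      then show ?thesis
        using component_le_l1_dist [OF True, of x c] x(2) r(2) [OF True] R(2) by force
    next
      case False
      then have "x i = c i" using x assms(2) W(2) by (auto simp: topspace_Euclidean_space)
      then show ?thesis using S(2) by auto
    qed
    then have "x \<in> W" using S(3) by auto
    then show ?thesis using x W(2) by (auto simp: topspace_Euclidean_space)
  qed
  then show ?thesis using that r(1) by blast
qed

text \<open>The ball is closed, being the preimage of a ray under the distance, and lies in a
  product of compact intervals with factor \<open>{0}\<close> from index \<open>m\<close> on. That
  product is compact by Tychonoff's theorem.\<close>

lemma compactin_l1_cball:
  assumes "c \<in> topspace (Euclidean_space m)"
  shows "compactin (Euclidean_space m) {x \<in> topspace (Euclidean_space m). l1_dist m x c \<le> r}"
proof -
  let ?B = "Pi\<^sub>E UNIV (\<lambda>i. if i < m then {c i - r..c i + r} else {0})"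
  have B: "compactin (powertop_real UNIV) ?B"
    unfolding compactin_PiE by auto
  have sub: "?B \<subseteq> topspace (Euclidean_space m)"
    by (auto simp: topspace_Euclidean_space PiE_iff split: if_splits)
  have "compactin (Euclidean_space m) ?B"
    using B sub unfolding Euclidean_space_def by (simp add: compactin_subtopology)
  moreover have "closedin (Euclidean_space m) {x \<in> topspace (Euclidean_space m). l1_dist m x c \<in> {..r}}"
    using assms by (intro closedin_continuous_map_preimage [of _ euclideanreal] continuous_map_l1_dist) auto
  moreover have "{x \<in> topspace (Euclidean_space m). l1_dist m x c \<in> {..r}} \<subseteq> ?B"
  proof
    fix x assume x: "x \<in> {x \<in> topspace (Euclidean_space m). l1_dist m x c \<in> {..r}}"
    have "x i \<in> (if i < m then {c i - r..c i + r} else {0})" for i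
      using x component_le_l1_dist [of i m x c] by (auto simp: topspace_Euclidean_space)
    then show "x \<in> ?B" by (intro PiE_I) auto
  qed
  ultimately show ?thesis
    using closed_compactin by fastforce
qed

subsection \<open>Transport on manifolds\<close>

text \<open>\<open>\<theta> ((a, b), z)\<close> is where \<open>z\<close> goes when \<open>a\<close> is moved to \<open>b\<close>; for fixed \<open>a\<close> and \<open>b\<close> it need
  not be injective, but only \<open>a\<close> may be sent to \<open>b\<close>.\<close>

definition has_transport :: "'b topology \<Rightarrow> 'b set \<Rightarrow> bool" where
  "has_transport Y P \<longleftrightarrow> (\<exists>\<theta>.
     continuous_map (prod_topology (prod_topology (subtopology Y P) (subtopology Y P)) Y) Y \<theta> \<and>
     (\<forall>a\<in>P. \<forall>z\<in>topspace Y. \<theta> ((a, a), z) = z) \<and>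
     (\<forall>a\<in>P. \<forall>b\<in>P. \<forall>z\<in>topspace Y. \<theta> ((a, b), z) = b \<longrightarrow> z = a))"

lemma manifold_chart_l1_cball:
  assumes "topological_manifold m Y" "p \<in> topspace Y"
  obtains U V h k r where "openin Y U" "p \<in> U" "openin (Euclidean_space m) V"
    "homeomorphic_maps (subtopology Y U) (subtopology (Euclidean_space m) V) h k"
    "0 < r" "{x \<in> topspace (Euclidean_space m). l1_dist m x (h p) \<le> r} \<subseteq> V"
proof -
  obtain U V h k where UV: "openin Y U" "p \<in> U" "openin (Euclidean_space m) V"
    and hk: "homeomorphic_maps (subtopology Y U) (subtopology (Euclidean_space m) V) h k"
    using assms unfolding topological_manifold_def homeomorphic_space_def by blast
  have "h p \<in> V"
    using hk UV assms(2) by (auto simp: homeomorphic_maps_def continuous_map_in_subtopology image_subset_iff)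
  then obtain r where "0 < r" "{x \<in> topspace (Euclidean_space m). l1_dist m x (h p) \<le> r} \<subseteq> V"
    using openin_Euclidean_space_contains_l1_cball [OF UV(3)] by blast
  with UV hk show ?thesis using that by blast
qed

text \<open>This serves twice: in a Hausdorff space the pulled-back ball is closed, so maps can be
  glued along its complement, and it supplies the compact neighbourhoods for local
  compactness.\<close>

lemma manifold_chart_l1_cball_compact:
  assumes "homeomorphic_maps (subtopology Y U) (subtopology (Euclidean_space m) V) h k"
    "{x \<in> topspace (Euclidean_space m). l1_dist m x (h p) \<le> r} \<subseteq> V"
    "p \<in> U" "openin Y U"
  shows "compactin Y (k ` {x \<in> topspace (Euclidean_space m). l1_dist m x (h p) \<le> r})"
proof -
  let ?B = "{x \<in> topspace (Euclidean_space m). l1_dist m x (h p) \<le> r}"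
  have "p \<in> topspace Y" using assms openin_subset by blast
  then have "h p \<in> topspace (Euclidean_space m)"
    using assms by (auto simp: homeomorphic_maps_def continuous_map_def)
  then have "compactin (Euclidean_space m) ?B" by (rule compactin_l1_cball)
  then have "compactin (subtopology (Euclidean_space m) V) ?B"
    using assms(2) by (simp add: compactin_subtopology)
  moreover have "continuous_map (subtopology (Euclidean_space m) V) Y k"
    using assms(1) by (auto simp: homeomorphic_maps_def continuous_map_in_subtopology)
  ultimately show ?thesis by (rule image_compactin)
qed

text \<open>In a chart the transport is \<open>push\<close> read in coordinates; elsewhere it leaves
  \<open>z\<close> alone. The two rules agree outside the compact set \<open>K\<close>, the
  pulled-back \<open>r\<close>-ball, because no push used here moves a point outside it.\<close>

lemma manifold_has_transport:
  assumes "topological_manifold m Y" "p \<in> topspace Y"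
  obtains P where "openin Y P" "p \<in> P" "has_transport Y P"
proof -
  obtain U V h k r where U: "openin Y U" "p \<in> U" and V: "openin (Euclidean_space m) V"
    and hk: "homeomorphic_maps (subtopology Y U) (subtopology (Euclidean_space m) V) h k"
    and r: "0 < r" and B: "{x \<in> topspace (Euclidean_space m). l1_dist m x (h p) \<le> r} \<subseteq> V" (is "?B \<subseteq> V")
    using manifold_chart_l1_cball [OF assms] .
  have Us: "U \<subseteq> topspace Y" using U openin_subset by blast
  have Vs: "V \<subseteq> topspace (Euclidean_space m)" using V openin_subset by blast
  have ch: "continuous_map (subtopology Y U) (Euclidean_space m) h"
    and ck: "continuous_map (subtopology (Euclidean_space m) V) Y k"
    and hV: "\<And>z. z \<in> U \<Longrightarrow> h z \<in> V" and kU: "\<And>x. x \<in> V \<Longrightarrow> k x \<in> U"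
    and kh: "\<And>z. z \<in> U \<Longrightarrow> k (h z) = z" and hk': "\<And>x. x \<in> V \<Longrightarrow> h (k x) = x"
    using hk Us Vs by (auto simp: homeomorphic_maps_def continuous_map_in_subtopology image_subset_iff Int_absorb1)
  have hE: "\<And>z. z \<in> U \<Longrightarrow> h z \<in> topspace (Euclidean_space m)" using hV Vs by blast
  define K where "K = k ` ?B"
  have "Hausdorff_space Y" using assms(1) by (simp add: topological_manifold_def)
  then have cK: "closedin Y K"
    unfolding K_def using manifold_chart_l1_cball_compact [OF hk B U(2,1)] compactin_imp_closedin by blast
  \<comment> \<open>The chart images of \<open>a\<close> and \<open>b\<close> will lie within
    \<open>\<rho> / 2\<close> of the centre \<open>h p\<close>. They are then less than
    \<open>\<rho>\<close> apart, as \<open>push_eq_target_imp\<close> demands, and the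
    \<open>\<rho>\<close>-ball about \<open>h a\<close> stays inside the \<open>r\<close>-ball about
    \<open>h p\<close>.\<close>
  define \<rho> where "\<rho> = r / 2"
  define P where "P = {z \<in> topspace (subtopology Y U). l1_dist m (h z) (h p) \<in> {..<\<rho> / 2}}"
  have "continuous_map (subtopology Y U) euclideanreal (\<lambda>z. l1_dist m (h z) (h p))"
    using hE U(2) by (intro continuous_map_l1_dist ch) auto
  then have "openin (subtopology Y U) P"
    unfolding P_def by (rule openin_continuous_map_preimage) auto
  then have oP: "openin Y P" using U(1) openin_trans_full by blast
  have pP: "p \<in> P" using U Us r by (auto simp: P_def \<rho>_def)
  have PU: "P \<subseteq> U" by (auto simp: P_def)
  have Pd: "l1_dist m (h b) (h a) < \<rho>" if "a \<in> P" "b \<in> P" for a b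
    using that l1_dist_triangle [of m "h b" "h a" "h p"] l1_dist_commute [of m "h a" "h p"]
    by (auto simp: P_def)
  define q where "q = (\<lambda>((a, b), z). push m \<rho> (h a) (h b) (h z))"
  have \<rho>: "0 < \<rho>" using r by (simp add: \<rho>_def)
  have qV: "q ((a, b), z) \<in> V" if "a \<in> P" "b \<in> P" "z \<in> U" for a b z
  proof (cases "l1_dist m (h z) (h a) < \<rho>")
    case True
    have "l1_dist m (q ((a, b), z)) (h a) \<le> \<rho>"
      using True Pd [OF that(1,2)] \<rho> by (simp add: q_def l1_dist_push_le)
    moreover have "l1_dist m (h a) (h p) < \<rho> / 2" using that by (simp add: P_def)
    ultimately have "l1_dist m (q ((a, b), z)) (h p) \<le> r"
      using l1_dist_triangle [of m "q ((a, b), z)" "h p" "h a"] r by (simp add: \<rho>_def)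
    moreover have "q ((a, b), z) \<in> topspace (Euclidean_space m)"
      using that PU hE by (auto simp: q_def intro!: push_in_Euclidean_space)
    ultimately show ?thesis using B by blast
  next
    case False
    then show ?thesis using push_far [OF \<rho>] hV that by (simp add: q_def)
  qed
  define \<theta> where "\<theta> = (\<lambda>w. if snd w \<in> U then k (q w) else snd w)"
  have outside: "\<theta> ((a, b), z) = z" if "a \<in> P" "b \<in> P" "z \<in> topspace Y - K" for a b z
  proof (cases "z \<in> U")
    case True
    have "\<not> l1_dist m (h z) (h p) \<le> r"
    proof
      assume "l1_dist m (h z) (h p) \<le> r"
      then have "h z \<in> ?B" using hE True by simp
      then have "z \<in> K" unfolding K_def using kh [OF True] by (intro image_eqI [of _ _ "h z"]) auto
      then show False using that by simp
    qed
    moreover have "l1_dist m (h a) (h p) < \<rho> / 2" using that by (simp add: P_def)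
    ultimately have "\<rho> \<le> l1_dist m (h z) (h a)"
      using l1_dist_triangle [of m "h z" "h p" "h a"] \<rho> by (simp add: \<rho>_def)
    then show ?thesis using push_far [OF \<rho>] True kh by (simp add: \<theta>_def q_def)
  qed (simp add: \<theta>_def)
  let ?PP = "prod_topology (subtopology Y P) (subtopology Y P)"
  let ?T = "prod_topology ?PP Y"
  have topPP: "topspace ?PP = P \<times> P" using PU Us by auto
  \<comment> \<open>The Boolean index selects one of two open sets: the part over the chart
    \<open>U\<close>, or the part over the complement of the closed set \<open>K\<close>. They cover
    everything because \<open>K \<subseteq> U\<close>.\<close>
  have c\<theta>: "continuous_map ?T Y \<theta>"
  proof (rule pasting_lemma [where I = UNIV and
        T = "\<lambda>i. if i then (P \<times> P) \<times> U else (P \<times> P) \<times> (topspace Y - K)" and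
        f = "\<lambda>i. if i then k \<circ> q else snd"])
    fix i :: bool
    show "openin ?T (if i then (P \<times> P) \<times> U else (P \<times> P) \<times> (topspace Y - K))"
      using U(1) cK topPP openin_topspace [of ?PP] by (auto simp: openin_prod_Times_iff)
    have "continuous_map (subtopology ?T ((P \<times> P) \<times> U)) Y (k \<circ> q)"
    proof (rule continuous_map_compose [OF _ ck])
      let ?S = "subtopology ?T ((P \<times> P) \<times> U)"
      have S: "?S = prod_topology ?PP (subtopology Y U)"
        using topPP by (metis subtopology_Times subtopology_topspace)
      have hP: "continuous_map (subtopology Y P) (Euclidean_space m) h"
        using ch PU by (metis continuous_map_from_subtopology_mono)
      have "continuous_map ?S (Euclidean_space m) q"
        unfolding S q_def case_prod_unfold
      proof (intro continuous_map_push \<rho>)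
        show "continuous_map (prod_topology ?PP (subtopology Y U)) (Euclidean_space m) (\<lambda>x. h (fst (fst x)))"
          using continuous_map_compose [OF continuous_map_compose [OF continuous_map_fst continuous_map_fst] hP]
          by (simp add: comp_def)
        show "continuous_map (prod_topology ?PP (subtopology Y U)) (Euclidean_space m) (\<lambda>x. h (snd (fst x)))"
          using continuous_map_compose [OF continuous_map_compose [OF continuous_map_fst continuous_map_snd] hP]
          by (simp add: comp_def)
        show "continuous_map (prod_topology ?PP (subtopology Y U)) (Euclidean_space m) (\<lambda>x. h (snd x))"
          using continuous_map_compose [OF continuous_map_snd ch] by (simp add: comp_def)
      qed
      then show "continuous_map ?S (subtopology (Euclidean_space m) V) q"
        unfolding continuous_map_in_subtopology using qV by auto
    qed
    then show "continuous_map (subtopology ?T (if i then (P \<times> P) \<times> U else (P \<times> P) \<times> (topspace Y - K))) Y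
                 (if i then k \<circ> q else snd)"
      by (auto intro: continuous_map_from_subtopology continuous_map_snd)
  next
    fix i j :: bool and x
    assume "x \<in> topspace ?T \<inter> (if i then (P \<times> P) \<times> U else (P \<times> P) \<times> (topspace Y - K)) \<inter>
              (if j then (P \<times> P) \<times> U else (P \<times> P) \<times> (topspace Y - K))"
    then show "(if i then k \<circ> q else snd) x = (if j then k \<circ> q else snd) x"
      using outside by (fastforce simp: \<theta>_def split: if_splits)
  next
    fix x assume x: "x \<in> topspace ?T"
    obtain a b z where [simp]: "x = ((a, b), z)" by (metis surj_pair)
    have K_U: "K \<subseteq> U" using kU B by (auto simp: K_def)
    show "\<exists>j. j \<in> UNIV \<and> x \<in> (if j then (P \<times> P) \<times> U else (P \<times> P) \<times> (topspace Y - K)) \<and>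
             \<theta> x = (if j then k \<circ> q else snd) x"
    proof (cases "z \<in> U")
      case True
      then show ?thesis using x by (intro exI [of _ True]) (auto simp: \<theta>_def)
    next
      case False
      then show ?thesis using x K_U by (intro exI [of _ False]) (auto simp: \<theta>_def)
    qed
  qed
  have "has_transport Y P"
    unfolding has_transport_def
  proof (intro exI [of _ \<theta>] conjI ballI impI)
    show "continuous_map ?T Y \<theta>" by (rule c\<theta>)
    show "\<theta> ((a, a), z) = z" if "a \<in> P" "z \<in> topspace Y" for a z
      using that kh by (simp add: \<theta>_def q_def)
    show "z = a" if "a \<in> P" "b \<in> P" "z \<in> topspace Y" "\<theta> ((a, b), z) = b" for a b z
    proof (cases "z \<in> U")
      case True
      then have "k (q ((a, b), z)) = b" using that by (simp add: \<theta>_def)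
      then have "q ((a, b), z) = h b" using hk' qV that True by metis
      then have "h z = h a"
        using push_eq_target_imp [OF Pd [OF that(1,2)]] hE True that PU by (auto simp: q_def)
      then show ?thesis using kh True that PU by (metis subsetD)
    next
      case False
      then show ?thesis using that PU by (auto simp: \<theta>_def)
    qed
  qed
  then show ?thesis using that oP pP by blast
qed

text \<open>Open coordinate balls lie in compact sets, so the space is locally compact Hausdorff and
  hence completely regular. This is the source of the bump functions used for the lifting.\<close>

lemma manifold_completely_regular:
  assumes "topological_manifold m Y"
  shows "completely_regular_space Y"
proof -
  have Hd: "Hausdorff_space Y" using assms by (simp add: topological_manifold_def)
  have "locally_compact_space Y"
    unfolding locally_compact_space_def
  proof
    fix p assume p: "p \<in> topspace Y"
    obtain U V h k r where U: "openin Y U" "p \<in> U" and V: "openin (Euclidean_space m) V"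
      and hk: "homeomorphic_maps (subtopology Y U) (subtopology (Euclidean_space m) V) h k"
      and r: "0 < r" and B: "{x \<in> topspace (Euclidean_space m). l1_dist m x (h p) \<le> r} \<subseteq> V" (is "?B \<subseteq> V")
      using manifold_chart_l1_cball [OF assms p] .
    have Us: "U \<subseteq> topspace Y" using U openin_subset by blast
    have ch: "continuous_map (subtopology Y U) (Euclidean_space m) h"
      using hk by (auto simp: homeomorphic_maps_def continuous_map_in_subtopology)
    have hE: "\<And>z. z \<in> U \<Longrightarrow> h z \<in> topspace (Euclidean_space m)"
      using ch Us by (auto simp: continuous_map_def)
    have kh: "\<And>z. z \<in> U \<Longrightarrow> k (h z) = z"
      using hk Us by (auto simp: homeomorphic_maps_def)
    let ?P = "{z \<in> topspace (subtopology Y U). l1_dist m (h z) (h p) \<in> {..<r}}"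
    have "continuous_map (subtopology Y U) euclideanreal (\<lambda>z. l1_dist m (h z) (h p))"
      using hE U(2) by (intro continuous_map_l1_dist ch) auto
    then have "openin (subtopology Y U) ?P"
      by (rule openin_continuous_map_preimage) auto
    then have "openin Y ?P" using U(1) openin_trans_full by blast
    moreover have "?P \<subseteq> k ` ?B"
    proof
      fix z assume "z \<in> ?P"
      then have "z \<in> U" "h z \<in> ?B" using hE by auto
      then show "z \<in> k ` ?B" using kh [of z] by (intro image_eqI [of _ _ "h z"]) auto
    qed
    moreover have "p \<in> ?P" using U Us r by auto
    ultimately show "\<exists>U K. openin Y U \<and> compactin Y K \<and> p \<in> U \<and> U \<subseteq> K"
      using manifold_chart_l1_cball_compact [OF hk B U(2,1)] by blast
  qed
  then show ?thesis
    using Hd by (intro locally_compact_regular_imp_completely_regular_space) auto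
qed

subsection \<open>Lifting homotopies to the configuration space\<close>

text \<open>A single move inside one transport set: \<open>\<psi>\<close> carries
  \<open>\<phi> z\<close> along while \<open>a z\<close> moves to \<open>b z\<close>. Hitting
  \<open>b z\<close> would force \<open>\<phi> z = a z\<close>, which is excluded. The last
  conclusion, that points rest where \<open>a\<close> and \<open>b\<close> agree, later makes
  infinite compositions locally finite.\<close>

lemma transport_step:
  assumes P: "openin Y P" "has_transport Y P"
    and a: "continuous_map Z Y a" and b: "continuous_map Z Y b" and \<phi>: "continuous_map Z Y \<phi>"
    and C: "closedin Z C" and abC: "\<And>z. z \<in> topspace Z - C \<Longrightarrow> a z = b z"
    and CP: "\<And>z. z \<in> C \<Longrightarrow> a z \<in> P \<and> b z \<in> P"
    and ne: "\<And>z. z \<in> topspace Z \<Longrightarrow> \<phi> z \<noteq> a z"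
  obtains \<psi> where "continuous_map Z Y \<psi>" "\<And>z. z \<in> topspace Z \<Longrightarrow> \<psi> z \<noteq> b z"
    "\<And>z. \<lbrakk>z \<in> topspace Z; a z = b z\<rbrakk> \<Longrightarrow> \<psi> z = \<phi> z"
proof -
  obtain \<theta> where c\<theta>: "continuous_map (prod_topology (prod_topology (subtopology Y P) (subtopology Y P)) Y) Y \<theta>"
    and \<theta>1: "\<And>a z. \<lbrakk>a \<in> P; z \<in> topspace Y\<rbrakk> \<Longrightarrow> \<theta> ((a, a), z) = z"
    and \<theta>2: "\<And>a b z. \<lbrakk>a \<in> P; b \<in> P; z \<in> topspace Y; \<theta> ((a, b), z) = b\<rbrakk> \<Longrightarrow> z = a"
    using P(2) unfolding has_transport_def by blast
  have \<phi>Y: "\<And>z. z \<in> topspace Z \<Longrightarrow> \<phi> z \<in> topspace Y"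
    using \<phi> by (auto simp: continuous_map_def)
  \<comment> \<open>\<open>Q\<close> is the open set on which the transport makes sense. It contains
    \<open>C\<close>, so \<open>Q\<close> and the complement of \<open>C\<close> cover
    \<open>Z\<close>; on their overlap \<open>a z = b z\<close> and the transport does
    nothing.\<close>
  define Q where "Q = {z \<in> topspace Z. a z \<in> P} \<inter> {z \<in> topspace Z. b z \<in> P}"
  have oQ: "openin Z Q"
    unfolding Q_def using P(1) a b by (intro openin_Int openin_continuous_map_preimage)
  have CZ: "C \<subseteq> topspace Z" using C closedin_subset by blast
  define \<psi> where "\<psi> = (\<lambda>z. if z \<in> Q then \<theta> ((a z, b z), \<phi> z) else \<phi> z)"
  have \<psi>_eq: "\<psi> z = \<phi> z" if "z \<in> topspace Z" "a z = b z" for z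
    using that \<theta>1 \<phi>Y by (simp add: \<psi>_def Q_def)
  have "continuous_map Z Y \<psi>"
  proof (rule pasting_lemma [where I = UNIV and T = "\<lambda>i. if i then Q else topspace Z - C" and
        f = "\<lambda>i. if i then \<theta> \<circ> (\<lambda>z. ((a z, b z), \<phi> z)) else \<phi>"])
    fix i :: bool
    show "openin Z (if i then Q else topspace Z - C)"
      using oQ C by auto
    have "continuous_map (subtopology Z Q) Y (\<theta> \<circ> (\<lambda>z. ((a z, b z), \<phi> z)))"
    proof (rule continuous_map_compose [OF _ c\<theta>], intro continuous_map_pairedI)
      show "continuous_map (subtopology Z Q) (subtopology Y P) a"
           "continuous_map (subtopology Z Q) (subtopology Y P) b"
        using a b by (auto simp: continuous_map_in_subtopology Q_def intro: continuous_map_from_subtopology)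
      show "continuous_map (subtopology Z Q) Y \<phi>"
        using \<phi> by (rule continuous_map_from_subtopology)
    qed
    then show "continuous_map (subtopology Z (if i then Q else topspace Z - C)) Y
                 (if i then \<theta> \<circ> (\<lambda>z. ((a z, b z), \<phi> z)) else \<phi>)"
      using \<phi> by (auto intro: continuous_map_from_subtopology)
  next
    fix i j :: bool and z
    assume "z \<in> topspace Z \<inter> (if i then Q else topspace Z - C) \<inter> (if j then Q else topspace Z - C)"
    then show "(if i then \<theta> \<circ> (\<lambda>z. ((a z, b z), \<phi> z)) else \<phi>) z = (if j then \<theta> \<circ> (\<lambda>z. ((a z, b z), \<phi> z)) else \<phi>) z"
      using \<psi>_eq [of z] abC [of z] by (auto simp: \<psi>_def split: if_splits)
  next
    fix z assume z: "z \<in> topspace Z"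
    show "\<exists>j. j \<in> UNIV \<and> z \<in> (if j then Q else topspace Z - C) \<and>
            \<psi> z = (if j then \<theta> \<circ> (\<lambda>z. ((a z, b z), \<phi> z)) else \<phi>) z"
    proof (cases "z \<in> Q")
      case True
      then show ?thesis by (intro exI [of _ True]) (simp add: \<psi>_def)
    next
      case False
      then have "z \<notin> C" using CP z by (auto simp: Q_def)
      then show ?thesis using False z by (intro exI [of _ False]) (simp add: \<psi>_def)
    qed
  qed
  moreover have "\<psi> z \<noteq> b z" if z: "z \<in> topspace Z" for z
  proof (cases "z \<in> Q")
    case True
    then show ?thesis using \<theta>2 [of "a z" "b z" "\<phi> z"] ne z \<phi>Y by (auto simp: \<psi>_def Q_def)
  next
    case False
    then have "z \<notin> C" using CP z by (auto simp: Q_def)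
    then have "a z = b z" using abC z by blast
    then show ?thesis using ne [OF z] False by (simp add: \<psi>_def)
  qed
  ultimately show ?thesis using that \<psi>_eq by blast
qed

lemma continuous_map_homotopy_graph:
  assumes "continuous_map (prod_topology (top_of_set {0..1}) Z) Y H"
    "continuous_map Z (top_of_set {0..1::real}) \<tau>"
  shows "continuous_map Z Y (\<lambda>z. H (\<tau> z, z))"
  using continuous_map_compose [OF continuous_map_pairedI [OF assms(2) continuous_map_id] assms(1)]
  by (simp add: comp_def)

text \<open>Over \<open>C\<close> the track of \<open>H\<close> visits \<open>P 0\<close>, ...,
  \<open>P (n - 1)\<close> in turn, staying in each for a time 1/n, and off \<open>C\<close> the
  time does not advance. The advance from \<open>\<alpha>\<close> to \<open>\<beta>\<close> is
  therefore cut into \<open>n\<close> moves, each an instance of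
  \<open>transport_step\<close>.\<close>

lemma transport_slab:
  fixes n :: nat and \<alpha> \<beta> :: "'a \<Rightarrow> real"
  assumes H: "continuous_map (prod_topology (top_of_set {0..1}) Z) Y H"
    and C: "closedin Z C" and n: "0 < n"
    and P: "\<And>i. i < n \<Longrightarrow> openin Y (P i)" "\<And>i. i < n \<Longrightarrow> has_transport Y (P i)"
    and HP: "\<And>i t z. \<lbrakk>i < n; t \<in> {real i / n..real (Suc i) / n}; z \<in> C\<rbrakk> \<Longrightarrow> H (t, z) \<in> P i"
    and \<alpha>: "continuous_map Z (top_of_set {0..1}) \<alpha>" and \<beta>: "continuous_map Z (top_of_set {0..1}) \<beta>"
    and le: "\<And>z. z \<in> topspace Z \<Longrightarrow> \<alpha> z \<le> \<beta> z"
    and eq: "\<And>z. z \<in> topspace Z - C \<Longrightarrow> \<alpha> z = \<beta> z"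
    and \<phi>: "continuous_map Z Y \<phi>" and ne: "\<And>z. z \<in> topspace Z \<Longrightarrow> \<phi> z \<noteq> H (\<alpha> z, z)"
  obtains \<psi> where "continuous_map Z Y \<psi>" "\<And>z. z \<in> topspace Z \<Longrightarrow> \<psi> z \<noteq> H (\<beta> z, z)"
    "\<And>z. \<lbrakk>z \<in> topspace Z; \<alpha> z = \<beta> z\<rbrakk> \<Longrightarrow> \<psi> z = \<phi> z"
proof -
  have CZ: "C \<subseteq> topspace Z" using C closedin_subset by blast
  have c\<alpha>: "continuous_map Z euclideanreal \<alpha>" and c\<beta>: "continuous_map Z euclideanreal \<beta>"
    and \<alpha>01: "\<And>z. z \<in> topspace Z \<Longrightarrow> \<alpha> z \<in> {0..1}" and \<beta>01: "\<And>z. z \<in> topspace Z \<Longrightarrow> \<beta> z \<in> {0..1}"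
    using \<alpha> \<beta> by (auto simp: continuous_map_in_subtopology)
  \<comment> \<open>Clipping \<open>i / n\<close> to \<open>[\<alpha>, \<beta>]\<close>: the time moves in step \<open>i\<close> only inside \<open>[i / n, (i + 1) / n]\<close>.\<close>
  define \<gamma> where "\<gamma> = (\<lambda>(i::nat) z. max (\<alpha> z) (min (\<beta> z) (real i / n)))"
  have c\<gamma>: "continuous_map Z euclideanreal (\<gamma> i)" for i
    unfolding \<gamma>_def by (intro continuous_intros c\<alpha> c\<beta>) auto
  have \<gamma>I: "continuous_map Z (top_of_set {0..1}) (\<gamma> i)" for i
  proof -
    have "\<gamma> i z \<in> {0..1}" if "z \<in> topspace Z" for z
      using \<alpha>01 [OF that] \<beta>01 [OF that] by (auto simp: \<gamma>_def le_max_iff_disj min_le_iff_disj)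
    then show ?thesis using c\<gamma> by (auto simp: continuous_map_in_subtopology)
  qed
  have "\<exists>\<psi>. continuous_map Z Y \<psi> \<and> (\<forall>z\<in>topspace Z. \<psi> z \<noteq> H (\<gamma> i z, z)) \<and>
          (\<forall>z\<in>topspace Z. \<alpha> z = \<beta> z \<longrightarrow> \<psi> z = \<phi> z)" if "i \<le> n" for i
    using that
  proof (induction i)
    case 0
    have "\<gamma> 0 z = \<alpha> z" if "z \<in> topspace Z" for z
      using \<alpha>01 [OF that] \<beta>01 [OF that] by (auto simp: \<gamma>_def)
    then show ?case using \<phi> ne by (intro exI [of _ \<phi>]) auto
  next
    case (Suc i)
    then obtain \<psi> where \<psi>: "continuous_map Z Y \<psi>" "\<And>z. z \<in> topspace Z \<Longrightarrow> \<psi> z \<noteq> H (\<gamma> i z, z)"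
       "\<And>z. \<lbrakk>z \<in> topspace Z; \<alpha> z = \<beta> z\<rbrakk> \<Longrightarrow> \<psi> z = \<phi> z" by auto
    \<comment> \<open>\<open>D\<close> holds the points of \<open>C\<close> whose
      \<open>i\<close>-th move starts no earlier than i/n and ends no later than (i+1)/n, so both
      ends of the move lie in \<open>P i\<close>. It is closed, and outside it the move is
      trivial.\<close>
    define D where "D = C \<inter> {z \<in> topspace Z. \<gamma> i z \<in> {real i / n..}} \<inter> {z \<in> topspace Z. \<gamma> (Suc i) z \<in> {..real (Suc i) / n}}"
    have "i < n" using Suc by simp
    have cD: "closedin Z D"
      unfolding D_def
      by (intro closedin_Int C closedin_continuous_map_preimage [OF c\<gamma>]) auto
    have mono: "\<gamma> i z \<le> \<gamma> (Suc i) z" for z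
      unfolding \<gamma>_def by (intro max.mono min.mono divide_right_mono) auto
    have out: "\<gamma> i z = \<gamma> (Suc i) z" if "z \<in> topspace Z - D" for z
    proof (cases "z \<in> C")
      case True
      \<comment> \<open>A bound fails only if [a, b] lies wholly below \<open>s\<close> or wholly
        above \<open>t\<close>; then both sides equal \<open>b\<close>, or both equal
        \<open>a\<close>.\<close>
      have clip: "max a (min b s) = max a (min b t)"
        if "s \<le> t" "a \<le> b" "\<not> (s \<le> max a (min b s) \<and> max a (min b t) \<le> t)" for a b s t :: real
        using that by linarith
      have "real i / n \<le> real (Suc i) / n" by (simp add: divide_right_mono)
      moreover have "\<alpha> z \<le> \<beta> z" using le that by blast
      moreover have "\<not> (real i / n \<le> \<gamma> i z \<and> \<gamma> (Suc i) z \<le> real (Suc i) / n)"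
        using True that by (auto simp: D_def)
      ultimately show ?thesis unfolding \<gamma>_def by (rule clip)
    next
      case False
      then show ?thesis using eq that by (simp add: \<gamma>_def)
    qed
    obtain \<xi> where \<xi>: "continuous_map Z Y \<xi>" "\<And>z. z \<in> topspace Z \<Longrightarrow> \<xi> z \<noteq> H (\<gamma> (Suc i) z, z)"
        "\<And>z. \<lbrakk>z \<in> topspace Z; H (\<gamma> i z, z) = H (\<gamma> (Suc i) z, z)\<rbrakk> \<Longrightarrow> \<xi> z = \<psi> z"
    proof (rule transport_step [OF P(1) [OF \<open>i < n\<close>] P(2) [OF \<open>i < n\<close>]
          continuous_map_homotopy_graph [OF H \<gamma>I] continuous_map_homotopy_graph [OF H \<gamma>I] \<psi>(1) cD])
      show "H (\<gamma> i z, z) = H (\<gamma> (Suc i) z, z)" if "z \<in> topspace Z - D" for z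
        using out [OF that] by simp
      show "H (\<gamma> i z, z) \<in> P i \<and> H (\<gamma> (Suc i) z, z) \<in> P i" if "z \<in> D" for z
      proof -
        have "z \<in> C" "real i / n \<le> \<gamma> i z" "\<gamma> (Suc i) z \<le> real (Suc i) / n" using that by (auto simp: D_def)
        then show ?thesis using mono [of z] by (auto intro!: HP [OF \<open>i < n\<close>])
      qed
    qed (use \<psi>(2) in auto)
    have "\<xi> z = \<phi> z" if "z \<in> topspace Z" "\<alpha> z = \<beta> z" for z
    proof -
      have "\<gamma> i z = \<gamma> (Suc i) z" using that by (simp add: \<gamma>_def)
      then show ?thesis using \<xi>(3) \<psi>(3) that by simp
    qed
    then show ?case using \<xi> by blast
  qed
  from this [of n] obtain \<psi> where \<psi>: "continuous_map Z Y \<psi>" "\<And>z. z \<in> topspace Z \<Longrightarrow> \<psi> z \<noteq> H (\<gamma> n z, z)"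
       "\<And>z. \<lbrakk>z \<in> topspace Z; \<alpha> z = \<beta> z\<rbrakk> \<Longrightarrow> \<psi> z = \<phi> z" by auto
  \<comment> \<open>Since \<open>0 < n\<close>, the last clipping value \<open>real n / n\<close> is
    1, an upper bound of \<open>\<beta>\<close>.\<close>
  moreover have "\<gamma> n z = \<beta> z" if "z \<in> topspace Z" for z
    using \<beta>01 [OF that] le [OF that] n by (auto simp: \<gamma>_def)
  ultimately show ?thesis using that by metis
qed

section \<open>Local data for the lifting: subdivided homotopy tracks and bump functions\<close>

text \<open>For each time t, some product neighbourhood of (t, z) is mapped into one member of the
  cover. A Lebesgue number of the time factors yields \<open>n\<close>, and \<open>N\<close> is the
  intersection of the \<open>n\<close> space factors that are used.\<close>

lemma homotopy_local_subdivision: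
  assumes H: "continuous_map (prod_topology (top_of_set {0..1::real}) Z) Y H"
    and cov: "\<And>y. y \<in> topspace Y \<Longrightarrow> \<exists>P\<in>\<P>. y \<in> P" and op: "\<And>P. P \<in> \<P> \<Longrightarrow> openin Y P"
    and z: "z \<in> topspace Z"
  obtains N n P where "openin Z N" "z \<in> N" "0 < n" "\<forall>i<n. P i \<in> \<P>"
    "\<forall>i<n. \<forall>t\<in>{real i / n..real (Suc i) / n}. \<forall>w\<in>N. H (t, w) \<in> P i"
proof -
  have "\<exists>J M P. open J \<and> t \<in> J \<and> openin Z M \<and> z \<in> M \<and> P \<in> \<P> \<and>
          (\<forall>s\<in>J \<inter> {0..1}. \<forall>w\<in>M. H (s, w) \<in> P)" if t: "t \<in> {0..1}" for t
  proof -
    have "H (t, z) \<in> topspace Y" using H t z by (auto simp: continuous_map_def)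
    then obtain P where P: "P \<in> \<P>" "H (t, z) \<in> P" using cov by blast
    have "openin (prod_topology (top_of_set {0..1}) Z)
            {x \<in> topspace (prod_topology (top_of_set {0..1}) Z). H x \<in> P}"
      using H op [OF P(1)] by (rule openin_continuous_map_preimage)
    then obtain J' M where JM: "openin (top_of_set {0..1}) J'" "openin Z M" "t \<in> J'" "z \<in> M"
        "J' \<times> M \<subseteq> {x \<in> topspace (prod_topology (top_of_set {0..1}) Z). H x \<in> P}"
      unfolding openin_prod_topology_alt using t z P(2) by (smt (verit) mem_Collect_eq mem_Sigma_iff topspace_prod_topology topspace_euclidean_subtopology)
    then obtain J where "open J" "J' = {0..1} \<inter> J" by (auto simp: openin_open)
    then show ?thesis using JM P by blast
  qed
  then obtain J M P where JMP: "\<And>t. t \<in> {0..1} \<Longrightarrow> open (J t) \<and> t \<in> J t \<and> openin Z (M t) \<and> z \<in> M t \<and> P t \<in> \<P> \<and>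
          (\<forall>s\<in>J t \<inter> {0..1}. \<forall>w\<in>M t. H (s, w) \<in> P t)"
    by metis
  obtain \<delta> where \<delta>: "0 < \<delta>" "\<And>T. \<lbrakk>T \<subseteq> {0..1::real}; diameter T < \<delta>\<rbrakk> \<Longrightarrow> \<exists>B\<in>J ` {0..1}. T \<subseteq> B"
  proof (rule Lebesgue_number_lemma [of "{0..1::real}" "J ` {0..1}"])
    show "{0..1} \<subseteq> \<Union> (J ` {0..1})" using JMP by blast
  qed (use JMP in auto)
  obtain m where m: "inverse (real (Suc m)) < \<delta>" using reals_Archimedean \<delta>(1) by blast
  define n where "n = Suc m"
  have n: "0 < n" "1 / real n < \<delta>" using m by (auto simp: n_def inverse_eq_divide)
  have "\<exists>t\<in>{0..1}. {real i / n..real (Suc i) / n} \<subseteq> J t" if "i < n" for i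
  proof -
    have "{real i / n..real (Suc i) / n} \<subseteq> {0..1}" using that by (auto simp: field_simps)
    moreover have "diameter {real i / n..real (Suc i) / n} < \<delta>"
      using n \<delta>(1) by (simp add: diameter_closed_interval diff_divide_distrib [symmetric])
    ultimately show ?thesis using \<delta>(2) by blast
  qed
  then obtain t where t: "\<And>i. i < n \<Longrightarrow> t i \<in> {0..1} \<and> {real i / n..real (Suc i) / n} \<subseteq> J (t i)" by metis
  define N where "N = (\<Inter>i\<in>{..<n}. M (t i))"
  have "openin Z N" unfolding N_def using n t JMP by (intro openin_INT2) auto
  moreover have "z \<in> N" using t JMP by (auto simp: N_def)
  moreover have "\<forall>i<n. \<forall>s\<in>{real i / n..real (Suc i) / n}. \<forall>w\<in>N. H (s, w) \<in> P (t i)"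
  proof (intro allI impI ballI)
    fix i s w
    assume that: "i < n" "s \<in> {real i / n..real (Suc i) / n}" "w \<in> N"
    have "0 \<le> real i / n" "real (Suc i) / n \<le> 1" using that(1) by auto
    then have "s \<in> {0..1}" using that by (meson atLeastAtMost_iff order_trans)
    then have "s \<in> J (t i) \<inter> {0..1}" using t [OF that(1)] that by auto
    moreover have "w \<in> M (t i)" using that by (auto simp: N_def)
    ultimately show "H (s, w) \<in> P (t i)" using JMP t [OF that(1)] by blast
  qed
  ultimately show ?thesis using that [of N n "\<lambda>i. P (t i)"] n(1) t JMP by blast
qed

text \<open>A function separating \<open>z\<close> from the complement of \<open>N\<close> is not
  enough: the time has to reach 1 on a whole neighbourhood of \<open>z\<close>, and must stay 0
  outside a closed subset of \<open>N\<close>.\<close>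

lemma completely_regular_bump:
  assumes "completely_regular_space Z" "openin Z N" "z \<in> N"
  obtains u W C where "continuous_map Z (top_of_set {0..1::real}) u" "openin Z W" "z \<in> W"
    "closedin Z C" "C \<subseteq> N" "\<And>w. w \<in> W \<Longrightarrow> u w = 1" "\<And>w. w \<in> topspace Z - C \<Longrightarrow> u w = 0"
proof -
  have z: "z \<in> topspace Z - (topspace Z - N)" "closedin Z (topspace Z - N)"
    using assms openin_subset by auto
  then obtain f :: "_ \<Rightarrow> real" where f: "continuous_map Z (top_of_set {0..1}) f" "f z = 0" "f ` (topspace Z - N) \<subseteq> {1}"
    using assms(1) unfolding completely_regular_space_def by blast
  have cf: "continuous_map Z euclideanreal f" using f by (simp add: continuous_map_in_subtopology)
  \<comment> \<open>The rescaling is 1 where \<open>f w \<le> 1/3\<close> and 0 where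
    \<open>f w \<ge> 2/3\<close>.\<close>
  define u where "u = (\<lambda>w. min 1 (max 0 (2 - 3 * f w)))"
  have cu: "continuous_map Z (top_of_set {0..1}) u"
    unfolding continuous_map_in_subtopology u_def
    by (intro conjI continuous_intros cf) auto
  show ?thesis
  proof (rule that [OF cu, of "{w \<in> topspace Z. f w \<in> {..<1/3}}" "{w \<in> topspace Z. f w \<in> {..2/3}}"])
    show "openin Z {w \<in> topspace Z. f w \<in> {..<1/3}}"
      by (rule openin_continuous_map_preimage [OF cf]) auto
    show "closedin Z {w \<in> topspace Z. f w \<in> {..2/3}}"
      by (rule closedin_continuous_map_preimage [OF cf]) auto
    show "{w \<in> topspace Z. f w \<in> {..2/3}} \<subseteq> N"
      using f(3) by fastforce
  qed (use z f in \<open>auto simp: u_def\<close>)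
qed

section \<open>Lifting along a whole homotopy\<close>

text \<open>The Lindelof property leaves countably many patches, which are processed one after
  another. Over the open set of a patch nothing moves once that patch has been processed, so the
  sequence of maps has a continuous limit. Of the lifted homotopy only the final map is
  recorded.\<close>

lemma transport_lift:
  assumes Z: "completely_regular_space Z" "Lindelof_space Z"
    and Y: "\<And>y. y \<in> topspace Y \<Longrightarrow> \<exists>P. openin Y P \<and> y \<in> P \<and> has_transport Y P"
    and H: "continuous_map (prod_topology (top_of_set {0..1::real}) Z) Y H"
    and \<phi>: "continuous_map Z Y \<phi>" "\<And>z. z \<in> topspace Z \<Longrightarrow> \<phi> z \<noteq> H (0, z)"
  obtains \<psi> where "continuous_map Z Y \<psi>" "\<And>z. z \<in> topspace Z \<Longrightarrow> \<psi> z \<noteq> H (1, z)"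
proof (cases "topspace Z = {}")
  case True
  then show ?thesis using that \<phi> by blast
next
  case False
  \<comment> \<open>A patch bundles a bump function with a subdivision of the homotopy over
    \<open>C\<close>, which is the local input of \<open>transport_slab\<close>.\<close>
  define patch where "patch = (\<lambda>W u C. continuous_map Z (top_of_set {0..1::real}) u \<and> openin Z W \<and> closedin Z C \<and>
      (\<forall>w\<in>W. u w = 1) \<and> (\<forall>w\<in>topspace Z - C. u w = 0) \<and>
      (\<exists>n P. 0 < n \<and> (\<forall>i<n. openin Y (P i) \<and> has_transport Y (P i)) \<and>
        (\<forall>i<n. \<forall>t\<in>{real i / n..real (Suc i) / n}. \<forall>w\<in>C. H (t, w) \<in> P i)))"
  have cov: "\<exists>P\<in>{P. openin Y P \<and> has_transport Y P}. y \<in> P" if "y \<in> topspace Y" for y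
    using Y [OF that] by blast
  have op: "openin Y P" if "P \<in> {P. openin Y P \<and> has_transport Y P}" for P
    using that by blast
  have ex: "\<exists>W u C. z \<in> W \<and> patch W u C" if z: "z \<in> topspace Z" for z
  proof -
    obtain N n P where N: "openin Z N" "z \<in> N" and n: "0 < n" and P: "\<forall>i<n. P i \<in> {P. openin Y P \<and> has_transport Y P}"
      and HP: "\<forall>i<n. \<forall>t\<in>{real i / n..real (Suc i) / n}. \<forall>w\<in>N. H (t, w) \<in> P i"
      using homotopy_local_subdivision [OF H cov op z] .
    obtain u W C where u: "continuous_map Z (top_of_set {0..1::real}) u" "openin Z W" "z \<in> W"
      "closedin Z C" "C \<subseteq> N" "\<And>w. w \<in> W \<Longrightarrow> u w = 1" "\<And>w. w \<in> topspace Z - C \<Longrightarrow> u w = 0"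
      using completely_regular_bump [OF Z(1) N] by metis
    have "patch W u C"
      unfolding patch_def
    proof (intro conjI ballI exI [of _ n] exI [of _ P] n)
      show "\<forall>i<n. openin Y (P i) \<and> has_transport Y (P i)" using P by blast
      show "\<forall>i<n. \<forall>t\<in>{real i / n..real (Suc i) / n}. \<forall>w\<in>C. H (t, w) \<in> P i"
        using HP u(5) by blast
    qed (use u in auto)
    then show ?thesis using u(3) by blast
  qed
  let ?\<U> = "{W. \<exists>u C. patch W u C}"
  have "(\<forall>W\<in>?\<U>. openin Z W) \<and> topspace Z \<subseteq> \<Union>?\<U>"
  proof (intro conjI ballI subsetI)
    show "openin Z W" if "W \<in> ?\<U>" for W using that unfolding patch_def by blast
    show "z \<in> \<Union>?\<U>" if "z \<in> topspace Z" for z using ex [OF that] by blast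
  qed
  then obtain \<V> where \<V>: "countable \<V>" "\<V> \<subseteq> ?\<U>" "topspace Z \<subseteq> \<Union>\<V>"
    using Z(2) unfolding Lindelof_space_alt by meson
  \<comment> \<open>A finite \<open>\<V>\<close> is enumerated with repetitions, which is harmless.
    The enumeration needs \<open>\<V>\<close> to be nonempty, hence the separate case of an empty
    \<open>Z\<close>.\<close>
  define W where "W = from_nat_into \<V>"
  have "\<V> \<noteq> {}" using \<V>(3) False by auto
  then have W\<V>: "range W = \<V>" unfolding W_def using \<V>(1) by (rule range_from_nat_into)
  then have "\<exists>u C. patch (W k) u C" for k using \<V>(2) by blast
  then obtain u C where uC: "\<And>k. patch (W k) (u k) (C k)" by metis
  define \<tau> where "\<tau> = rec_nat (\<lambda>z. 0) (\<lambda>k f z. max (f z) (u k z))"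
  have \<tau>0: "\<tau> 0 = (\<lambda>z. 0)" and \<tau>S: "\<tau> (Suc k) = (\<lambda>z. max (\<tau> k z) (u k z))" for k
    by (auto simp: \<tau>_def)
  have uI: "continuous_map Z (top_of_set {0..1}) (u k)" and oW: "openin Z (W k)" and cC: "closedin Z (C k)"
    and u1: "\<And>w. w \<in> W k \<Longrightarrow> u k w = 1" and u0: "\<And>w. w \<in> topspace Z - C k \<Longrightarrow> u k w = 0" for k
    using uC [of k] unfolding patch_def by blast+
  have cu: "continuous_map Z euclideanreal (u k)" and u01: "\<And>z. z \<in> topspace Z \<Longrightarrow> u k z \<in> {0..1}" for k
    using uI [of k] unfolding continuous_map_in_subtopology by blast+
  have c\<tau>: "continuous_map Z (top_of_set {0..1}) (\<tau> k)" for k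
  proof (induction k)
    case (Suc k)
    then have "continuous_map Z euclideanreal (\<tau> (Suc k))"
      unfolding \<tau>S continuous_map_in_subtopology by (intro continuous_intros cu) auto
    moreover have "\<tau> (Suc k) z \<in> {0..1}" if "z \<in> topspace Z" for z
    proof -
      have "\<tau> k z \<in> {0..1}" using Suc that unfolding continuous_map_in_subtopology by blast
      then show ?thesis using u01 [OF that, of k] by (auto simp: \<tau>S max_def)
    qed
    ultimately show ?case unfolding continuous_map_in_subtopology by blast
  qed (simp add: \<tau>0)
  have \<tau>01: "\<tau> k z \<in> {0..1}" if "z \<in> topspace Z" for k z
    using c\<tau> [of k] that unfolding continuous_map_in_subtopology by blast
  have \<tau>mono: "j \<le> k \<Longrightarrow> \<tau> j z \<le> \<tau> k z" for j k z
    by (rule lift_Suc_mono_le [of "\<lambda>k. \<tau> k z"]) (auto simp: \<tau>S)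
  \<comment> \<open>The bump \<open>u j\<close> enters in the step from \<open>j\<close> to
    \<open>Suc j\<close>, so over \<open>W j\<close> the time is 1 from index \<open>Suc j\<close>
    on.\<close>
  have \<tau>1: "\<tau> k z = 1" if "z \<in> topspace Z" "z \<in> W j" "j < k" for j k z
  proof -
    have "u j z = 1" using u1 that by blast
    then have "1 \<le> \<tau> (Suc j) z" by (auto simp: \<tau>S max_def)
    also have "\<dots> \<le> \<tau> k z" using that by (intro \<tau>mono) auto
    finally show ?thesis using \<tau>01 [OF that(1), of k] by auto
  qed
  define good where "good = (\<lambda>k \<psi>. continuous_map Z Y \<psi> \<and> (\<forall>z\<in>topspace Z. \<psi> z \<noteq> H (\<tau> k z, z)))"
  \<comment> \<open>Each map is obtained from its predecessor by an existence statement, hence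
    dependent choice. The second clause records that a point rests while its time stands
    still.\<close>
  have "\<exists>\<Phi>. \<forall>k. good k (\<Phi> k) \<and> (\<forall>z\<in>topspace Z. \<tau> k z = \<tau> (Suc k) z \<longrightarrow> \<Phi> (Suc k) z = \<Phi> k z)"
  proof (rule dependent_nat_choice)
    show "\<exists>\<psi>. good 0 \<psi>" using \<phi> by (auto simp: good_def \<tau>0)
    fix \<psi> k assume "good k \<psi>"
    then have \<psi>: "continuous_map Z Y \<psi>" "\<And>z. z \<in> topspace Z \<Longrightarrow> \<psi> z \<noteq> H (\<tau> k z, z)"
      by (auto simp: good_def)
    obtain n P where n: "0 < n" and P: "\<And>i. i < n \<Longrightarrow> openin Y (P i)" "\<And>i. i < n \<Longrightarrow> has_transport Y (P i)"
      and HP: "\<And>i t w. \<lbrakk>i < n; t \<in> {real i / n..real (Suc i) / n}; w \<in> C k\<rbrakk> \<Longrightarrow> H (t, w) \<in> P i"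
      using uC [of k] unfolding patch_def by blast
    obtain \<xi> where "continuous_map Z Y \<xi>" "\<And>z. z \<in> topspace Z \<Longrightarrow> \<xi> z \<noteq> H (\<tau> (Suc k) z, z)"
        "\<And>z. \<lbrakk>z \<in> topspace Z; \<tau> k z = \<tau> (Suc k) z\<rbrakk> \<Longrightarrow> \<xi> z = \<psi> z"
    proof (rule transport_slab [OF H cC n P HP c\<tau> c\<tau> _ _ \<psi>])
      show "\<tau> k z \<le> \<tau> (Suc k) z" for z by (rule \<tau>mono) simp
      show "\<tau> k z = \<tau> (Suc k) z" if "z \<in> topspace Z - C k" for z
        using u0 [OF that] \<tau>01 [of z k] that by (auto simp: \<tau>S max_def)
    qed blast+
    then show "\<exists>\<xi>. good (Suc k) \<xi> \<and> (\<forall>z\<in>topspace Z. \<tau> k z = \<tau> (Suc k) z \<longrightarrow> \<xi> z = \<psi> z)"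
      by (auto simp: good_def)
  qed
  then obtain \<Phi> where \<Phi>: "\<And>k. good k (\<Phi> k)"
      "\<And>k z. \<lbrakk>z \<in> topspace Z; \<tau> k z = \<tau> (Suc k) z\<rbrakk> \<Longrightarrow> \<Phi> (Suc k) z = \<Phi> k z"
    by blast
  have stable: "\<Phi> k z = \<Phi> (Suc j) z" if "z \<in> topspace Z" "z \<in> W j" "Suc j \<le> k" for j k z
    using that(3)
  proof (induction k rule: dec_induct)
    case (step k)
    then show ?case using \<Phi>(2) [of z k] \<tau>1 [of z j] that by auto
  qed simp
  have cov: "\<exists>j. z \<in> W j" if "z \<in> topspace Z" for z
    using \<V>(3) W\<V> that by blast
  \<comment> \<open>The limit is \<open>\<Phi> (Suc j)\<close> on \<open>W j\<close>. On an overlap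
    the candidates agree, since the sequence is already constant there from the smaller of the two
    indices on.\<close>
  obtain \<psi> where \<psi>: "continuous_map Z Y \<psi>" "\<And>z j. \<lbrakk>j \<in> UNIV; z \<in> topspace Z \<inter> W j\<rbrakk> \<Longrightarrow> \<psi> z = \<Phi> (Suc j) z"
  proof (rule pasting_lemma_exists [where X = Z and I = UNIV and T = W and Y = Y and f = "\<lambda>j. \<Phi> (Suc j)"])
    show "topspace Z \<subseteq> (\<Union>i\<in>UNIV. W i)" using cov by blast
    show "openin Z (W i)" for i by (rule oW)
    show "continuous_map (subtopology Z (W i)) Y (\<Phi> (Suc i))" for i
      using \<Phi>(1) by (auto simp: good_def intro: continuous_map_from_subtopology)
    show "\<Phi> (Suc i) x = \<Phi> (Suc j) x" if "x \<in> topspace Z \<inter> W i \<inter> W j" for i j x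
      using stable [of x i "Suc j"] stable [of x j "Suc i"] that by (cases "i \<le> j") auto
  qed blast+
  moreover have "\<psi> z \<noteq> H (1, z)" if z: "z \<in> topspace Z" for z
  proof -
    obtain j where j: "z \<in> W j" using cov z by blast
    have "\<Phi> (Suc j) z \<noteq> H (\<tau> (Suc j) z, z)" using \<Phi>(1) z by (auto simp: good_def)
    then show ?thesis using \<tau>1 [OF z j] \<psi>(2) [of j z] z j by simp
  qed
  ultimately show ?thesis using that by blast
qed

subsection \<open>Sections and coincidences\<close>

text \<open>Shifting the first coordinate of the chart image of a point by \<open>r\<close> stays in
  the ball and gives a second point. Two points are needed for a cover by two sets in the bound on
  the relative sectional number.\<close>

lemma manifold_nontrivial:
  assumes "topological_manifold m Y" "0 < m" "topspace Y \<noteq> {}"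
  obtains y1 y2 where "y1 \<in> topspace Y" "y2 \<in> topspace Y" "y1 \<noteq> y2"
proof -
  obtain p where p: "p \<in> topspace Y" using assms by blast
  obtain U V h k r where U: "openin Y U" "p \<in> U" and "openin (Euclidean_space m) V"
    and hk: "homeomorphic_maps (subtopology Y U) (subtopology (Euclidean_space m) V) h k"
    and r: "0 < r" and B: "{x \<in> topspace (Euclidean_space m). l1_dist m x (h p) \<le> r} \<subseteq> V"
    using manifold_chart_l1_cball [OF assms(1) p] .
  have hp: "h p \<in> topspace (Euclidean_space m)"
    using hk U p by (auto simp: homeomorphic_maps_def continuous_map_def)
  define x where "x = (h p)(0 := h p 0 + r)"
  have x: "x \<in> topspace (Euclidean_space m)"
    using hp assms(2) by (auto simp: x_def topspace_Euclidean_space)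
  have "l1_dist m x (h p) = (\<Sum>i<m. if i = 0 then r else 0)"
    unfolding l1_dist_def by (rule sum.cong) (use r in \<open>auto simp: x_def\<close>)
  also have "\<dots> = r" using assms(2) by simp
  finally have xV: "x \<in> V" using x B by auto
  have "k x \<in> topspace Y" "h (k x) = x"
    using hk x xV by (auto simp: homeomorphic_maps_def continuous_map_def Pi_iff)
  moreover have "x \<noteq> h p" using r by (auto simp: x_def fun_eq_iff)
  ultimately show ?thesis using that p by metis
qed

section \<open>Sectional category one, fixed points and coincidences\<close>

text \<open>A finite infimum of extended naturals is attained, so some cover has exactly one member,
  which must be the whole space. An empty \<open>Y\<close> would be covered by no sets at all and
  give the value 0.\<close>

lemma sectional_category_eq_1_imp_section:
  assumes "sectional_category X Y g = 1"
  obtains s where "continuous_map Y X s" "homotopic_with (\<lambda>_. True) Y Y (g \<circ> s) id" "topspace Y \<noteq> {}"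
proof -
  define S where "S = {enat (card \<U>) | \<U>. finite \<U> \<and> \<Union>\<U> = topspace Y \<and>
       (\<forall>U\<in>\<U>. openin Y U \<and>
          (\<exists>s. continuous_map (subtopology Y U) X s \<and>
               homotopic_with (\<lambda>_. True) (subtopology Y U) Y (g \<circ> s) id))}"
  have 1: "Inf S = 1" using assms by (simp add: sectional_category_def S_def)
  then have "S \<noteq> {}" by (auto simp: Inf_enat_def one_enat_def)
  then have "Inf S \<in> S" by (auto simp: Inf_enat_def intro: LeastI)
  then obtain \<U> where \<U>: "card \<U> = 1" "\<Union>\<U> = topspace Y"
       "\<And>U. U\<in>\<U> \<Longrightarrow> (\<exists>s. continuous_map (subtopology Y U) X s \<and>
               homotopic_with (\<lambda>_. True) (subtopology Y U) Y (g \<circ> s) id)"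
    using 1 by (auto simp: S_def one_enat_def)
  then obtain U where "\<U> = {U}" using card_1_singletonE by metis
  then have "\<exists>s. continuous_map Y X s \<and> homotopic_with (\<lambda>_. True) Y Y (g \<circ> s) id"
    using \<U> by (auto simp: subtopology_topspace)
  moreover have "topspace Y \<noteq> {}"
  proof
    assume "topspace Y = {}"
    then have "enat (card {}) \<in> S" unfolding S_def by (intro CollectI exI [of _ "{}"]) auto
    then have "Inf S \<le> 0" by (intro Inf_lower) (simp add: zero_enat_def)
    then show False using 1 by simp
  qed
  ultimately show ?thesis using that by blast
qed

text \<open>A homotopy inverse is a section up to homotopy over the whole space. Nonemptiness of
  \<open>Y\<close> rules out the empty cover and with it the value 0.\<close>

lemma homotopy_equivalence_imp_sectional_category_eq_1:
  assumes "homotopy_equivalence X Y g" "topspace Y \<noteq> {}"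
  shows "sectional_category X Y g = 1"
proof (rule antisym)
  obtain h where h: "continuous_map Y X h" "homotopic_with (\<lambda>_. True) Y Y (g \<circ> h) id"
    using assms by (auto simp: homotopy_equivalence_def)
  show "sectional_category X Y g \<le> 1"
    unfolding sectional_category_def
    by (rule Inf_lower, rule CollectI, rule exI [of _ "{topspace Y}"])
       (use h in \<open>auto simp: one_enat_def subtopology_topspace\<close>)
  show "1 \<le> sectional_category X Y g"
    unfolding sectional_category_def
  proof (rule Inf_greatest, clarify)
    fix \<U> assume "finite \<U>" "\<Union>\<U> = topspace Y"
    then have "card \<U> \<noteq> 0" using assms(2) by (metis Union_empty card_0_eq)
    then show "1 \<le> enat (card \<U>)" by (simp add: one_enat_def)
  qed
qed

lemma fixed_point_property_imp_coincidence_property: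
  assumes man: "topological_manifold m Y" and g: "continuous_map X Y g"
    and s: "continuous_map Y X s" and hom: "homotopic_with (\<lambda>_. True) Y Y (g \<circ> s) id"
    and fpp: "fixed_point_property Y"
  shows "coincidence_property X Y g"
  unfolding coincidence_property_def
proof (intro allI impI, rule ccontr)
  fix f assume f: "continuous_map X Y f" and "\<not> (\<exists>x\<in>topspace X. f x = g x)"
  then have ne: "\<And>y. y \<in> topspace Y \<Longrightarrow> (f \<circ> s) y \<noteq> (g \<circ> s) y"
    using s by (auto simp: continuous_map_def)
  obtain H where H: "continuous_map (prod_topology (top_of_set {0..1::real}) Y) Y H"
      "\<And>y. H (0, y) = (g \<circ> s) y" "\<And>y. H (1, y) = y"
    using hom unfolding homotopic_with_def by auto
  have "second_countable Y"
    using man by (simp add: topological_manifold_def second_countable_space_def second_countable_def)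
  then have L: "Lindelof_space Y" by (rule second_countable_imp_Lindelof_space)
  obtain \<psi> where "continuous_map Y Y \<psi>" "\<And>y. y \<in> topspace Y \<Longrightarrow> \<psi> y \<noteq> H (1, y)"
  \<comment> \<open>The parameter space is \<open>Y\<close> itself. The homotopy ends at the
    identity, so a map avoiding its end has no fixed point.\<close>
  proof (rule transport_lift [OF manifold_completely_regular [OF man] L _ H(1), of "f \<circ> s"])
    show "\<exists>P. openin Y P \<and> y \<in> P \<and> has_transport Y P" if "y \<in> topspace Y" for y
      using manifold_has_transport [OF man that] by metis
    show "continuous_map Y Y (f \<circ> s)" using s f by (rule continuous_map_compose)
    show "(f \<circ> s) y \<noteq> H (0, y)" if "y \<in> topspace Y" for y using ne [OF that] H(2) by simp
  qed blast
  then show False using fpp H(3) by (auto simp: fixed_point_property_def)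
qed

text \<open>If \<open>f \<circ> g\<close> and \<open>g\<close> coincide at \<open>x\<close>, then
  \<open>g x\<close> is a fixed point of \<open>f\<close>.\<close>

lemma coincidence_property_imp_fixed_point_property:
  assumes "continuous_map X Y g" "coincidence_property X Y g"
  shows "fixed_point_property Y"
  unfolding fixed_point_property_def
proof (intro allI impI)
  fix f assume "continuous_map Y Y f"
  then obtain x where "x \<in> topspace X" "(f \<circ> g) x = g x"
    using assms continuous_map_compose unfolding coincidence_property_def by metis
  then show "\<exists>y\<in>topspace Y. f y = y"
    using assms(1) by (intro bexI [of _ "g x"]) (auto simp: continuous_map_def)
qed

section \<open>The relative sectional number of the configuration space projection\<close>

text \<open>A point of the fibre product over \<open>x\<close> has the form
  \<open>(x, (g x, y))\<close> with \<open>y \<noteq> g x\<close>, so a section amounts to a choice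
  of \<open>y\<close> depending continuously on \<open>x\<close>.\<close>

lemma fibre_product_configuration_section_iff:
  assumes "U \<subseteq> topspace X" "continuous_map X Y g"
  shows "(\<exists>s. continuous_map (subtopology X U) (fibre_product X (configuration_space2 Y) g fst) s \<and>
            (\<forall>x\<in>U. fst (s x) = x)) \<longleftrightarrow>
         (\<exists>f. continuous_map (subtopology X U) Y f \<and> (\<forall>x\<in>U. f x \<noteq> g x))"
  (is "?L \<longleftrightarrow> ?R")
proof
  let ?F = "fibre_product X (configuration_space2 Y) g fst"
  assume ?L
  then obtain s where s: "continuous_map (subtopology X U) ?F s" "\<And>x. x \<in> U \<Longrightarrow> fst (s x) = x" by blast
  have "continuous_map ?F (configuration_space2 Y) snd"
    unfolding fibre_product_def by (intro continuous_map_from_subtopology continuous_map_snd)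
  moreover have "continuous_map (configuration_space2 Y) Y snd"
    unfolding configuration_space2_def by (intro continuous_map_from_subtopology continuous_map_snd)
  ultimately have "continuous_map (subtopology X U) Y (snd \<circ> (snd \<circ> s))"
    by (intro continuous_map_compose [OF continuous_map_compose [OF s(1)]])
  moreover have "(snd \<circ> (snd \<circ> s)) x \<noteq> g x" if x: "x \<in> U" for x
  proof -
    have "s x \<in> topspace ?F" using s(1) x assms(1) by (auto simp: continuous_map_def)
    then show ?thesis
      using s(2) [OF x] by (auto simp: fibre_product_def configuration_space2_def)
  qed
  ultimately show ?R by blast
next
  let ?F = "fibre_product X (configuration_space2 Y) g fst"
  assume ?R
  then obtain f where f: "continuous_map (subtopology X U) Y f" "\<And>x. x \<in> U \<Longrightarrow> f x \<noteq> g x" by blast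
  have "continuous_map (subtopology X U) (configuration_space2 Y) (\<lambda>x. (g x, f x))"
    unfolding configuration_space2_def continuous_map_in_subtopology
  proof (intro conjI continuous_map_pairedI continuous_map_from_subtopology [OF assms(2)] f(1))
    show "(\<lambda>x. (g x, f x)) \<in> topspace (subtopology X U) \<rightarrow> {(y1, y2). y1 \<noteq> y2}"
      using f(2) by fastforce
  qed
  moreover have "continuous_map (subtopology X U) X (\<lambda>x. x)"
    by (rule continuous_map_from_subtopology) simp
  ultimately have "continuous_map (subtopology X U) ?F (\<lambda>x. (x, (g x, f x)))"
    unfolding fibre_product_def continuous_map_in_subtopology
    by (auto intro: continuous_map_pairedI)
  then show ?L by force
qed

text \<open>For the upper bound, the constant maps at \<open>y1\<close> and \<open>y2\<close> avoid
  \<open>g\<close> on the two sets where \<open>g\<close> misses the respective point; these are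
  open because points are closed, and they cover \<open>X\<close>. For the lower bound, a single set
  would give a global map without coincidence, and the empty cover would need an empty
  \<open>X\<close>, whereas a constant map already has a coincidence point.\<close>

lemma coincidence_property_imp_relative_sectional_number_eq_2:
  assumes Y: "t1_space Y" and y: "y1 \<in> topspace Y" "y2 \<in> topspace Y" "y1 \<noteq> y2"
    and g: "continuous_map X Y g" and cp: "coincidence_property X Y g"
  shows "relative_sectional_number X (configuration_space2 Y) g fst = 2"
proof (rule antisym)
  have two: "(2::enat) = enat 2" by (simp add: numeral_eq_enat)
  let ?W = "\<lambda>y. {x \<in> topspace X. g x \<in> topspace Y - {y}}"
  have oW: "openin X (?W y)" if "y \<in> topspace Y" for y
    using openin_continuous_map_preimage [OF g, of "topspace Y - {y}"] Y that
    by (auto simp: t1_space_closedin_singleton)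
  have sW: "\<exists>f. continuous_map (subtopology X (?W y)) Y f \<and> (\<forall>x\<in>?W y. f x \<noteq> g x)" if "y \<in> topspace Y" for y
    using that by (intro exI [of _ "\<lambda>_. y"]) auto
  have WX: "?W y \<subseteq> topspace X" for y by auto
  have "relative_sectional_number X (configuration_space2 Y) g fst \<le> enat (card {?W y1, ?W y2})"
    unfolding relative_sectional_number_def sectional_number_def
  proof (rule Inf_lower, rule CollectI, rule exI [of _ "{?W y1, ?W y2}"], intro conjI)
    show "\<Union>{?W y1, ?W y2} = topspace X"
      using y g by (auto simp: continuous_map_def)
    show "\<forall>U\<in>{?W y1, ?W y2}. openin X U \<and>
       (\<exists>s. continuous_map (subtopology X U) (fibre_product X (configuration_space2 Y) g fst) s \<and>
          (\<forall>x\<in>U. fst (s x) = x))"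
      using oW y sW fibre_product_configuration_section_iff [OF WX g] by simp
  qed auto
  also have "\<dots> \<le> 2" unfolding two by (simp add: card_insert_if)
  finally show "relative_sectional_number X (configuration_space2 Y) g fst \<le> 2" .
  show "2 \<le> relative_sectional_number X (configuration_space2 Y) g fst"
    unfolding relative_sectional_number_def sectional_number_def
  proof (rule Inf_greatest, clarify)
    fix \<U> assume fin: "finite \<U>" and \<U>: "\<Union>\<U> = topspace X"
      and sec: "\<forall>U\<in>\<U>. openin X U \<and>
       (\<exists>s. continuous_map (subtopology X U) (fibre_product X (configuration_space2 Y) g fst) s \<and>
          (\<forall>x\<in>U. fst (s x) = x))"
    have "topspace X \<notin> \<U>"
    proof
      assume "topspace X \<in> \<U>"
      then have "\<exists>f. continuous_map X Y f \<and> (\<forall>x\<in>topspace X. f x \<noteq> g x)"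
        using sec fibre_product_configuration_section_iff [OF subset_refl g]
        by (metis subtopology_topspace)
      then show False using cp by (auto simp: coincidence_property_def)
    qed
    moreover have "topspace X \<noteq> {}"
    proof -
      have "continuous_map X Y (\<lambda>_. y1)" using y by simp
      then show ?thesis using cp unfolding coincidence_property_def by blast
    qed
    ultimately have "\<U> \<noteq> {}" "\<nexists>U. \<U> = {U}"
      using \<U> by (metis Union_empty, metis ccpo_Sup_singleton singletonI)
    then have "card \<U> \<noteq> 0" "card \<U> \<noteq> 1"
      using fin by (auto simp: card_1_singleton_iff)
    then show "2 \<le> enat (card \<U>)" unfolding two by simp
  qed
qed

theorem proposition3p10:
  fixes X :: "'a topology" and Y :: "'b topology" and g :: "'a \<Rightarrow> 'b" and m :: nat
  assumes "m \<ge> 2"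
    and "topological_manifold m Y"
    and "connected_space Y"
    and "continuous_map X Y g"
  shows "(homotopy_equivalence X Y g \<and> topspace Y \<noteq> {} \<longrightarrow> sectional_category X Y g = 1) \<and>
    (sectional_category X Y g = 1 \<longrightarrow>
      (fixed_point_property Y \<longrightarrow>
         coincidence_property X Y g \<and>
         relative_sectional_number X (configuration_space2 Y) g fst = 2) \<and>
      (fixed_point_property Y \<longleftrightarrow> coincidence_property X Y g))"
proof (intro conjI impI)
  show "sectional_category X Y g = 1" if "homotopy_equivalence X Y g \<and> topspace Y \<noteq> {}"
    using that homotopy_equivalence_imp_sectional_category_eq_1 by blast
next
  assume sc: "sectional_category X Y g = 1"
  obtain s where s: "continuous_map Y X s" "homotopic_with (\<lambda>_. True) Y Y (g \<circ> s) id" and ne: "topspace Y \<noteq> {}"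
    using sectional_category_eq_1_imp_section [OF sc] .
  have cp: "coincidence_property X Y g" if "fixed_point_property Y"
    using fixed_point_property_imp_coincidence_property [OF assms(2,4) s that] .
  then show "fixed_point_property Y \<longleftrightarrow> coincidence_property X Y g"
    using coincidence_property_imp_fixed_point_property [OF assms(4)] by blast
  assume "fixed_point_property Y"
  then show "coincidence_property X Y g" by (rule cp)
  then show "relative_sectional_number X (configuration_space2 Y) g fst = 2"
    using manifold_nontrivial [OF assms(2) _ ne] assms(1,2,4) Hausdorff_imp_t1_space
      coincidence_property_imp_relative_sectional_number_eq_2
    by (metis (no_types, lifting) order_less_le_trans pos2 topological_manifold_def)
qed

end
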